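(* Let $n=n_1+n_2+n_3=p+q$ with $\min(n_1,n_2,n_3)\ge 2$, $p=2$ and $q=n-2$. Let $G=U(n)$, and let $L=U(n_1)\times U(n_2)\times U(n_3)$ and $H=U(p)\times U(q)$ be the natural block-diagonal subgroups of $G$. Define the abelian subspaces of $\mathfrak{u}(n)$ $$\mathfrak a_1:=\mathbb{R}(E_{1,n}-E_{n,1})+\mathbb{R}(E_{2,n-1}-E_{n-1,2}),\quad \mathfrak a':=\mathbb{R}(E_{n_1+1,n-1}-E_{n-1,n_1+1}),$$ $$\mathfrak a_2:=\mathbb{R}(E_{n_1+1,n}-E_{n,n_1+1})+\mathbb{R}(E_{n_1+2,n-1}-E_{n-1,n_1+2}),$$ the toral subgroups $A_1:=\exp\mathfrak a_1$, $A':=\exp\mathfrak a'$, $A_2:=\exp\mathfrak a_2$ of $O(n)$, and the subset $B:=A_2A'A_1=\{xyz:x\in A_2,y\in A',z\in A_1\}\subset O(n)$. Then $G=LBH$.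
   Context: $E_{ij}$ denotes the $n\times n$ matrix unit with $1$ in position $(i,j)$ and $0$ elsewhere. $LBH=\{xbh:x\in L,b\in B,h\in H\}$. *)

theory Defs
  imports "Jordan_Normal_Form.Schur_Decomposition" Complex_Main
begin

definition unitary_group :: "nat \<Rightarrow> complex mat set" where
  "unitary_group n = {A \<in> carrier_mat n n. mat_adjoint A * A = 1\<^sub>m n}"

text \<open>Matrix unit E_{ij} of size n, with the paper's 1-based indices i j.\<close>
definition matunit :: "nat \<Rightarrow> nat \<Rightarrow> nat \<Rightarrow> complex mat" where
  "matunit n i j = mat n n (\<lambda>(a, b). if a = i - 1 \<and> b = j - 1 then 1 else 0)"

definition mat_exp :: "complex mat \<Rightarrow> complex mat" where
  "mat_exp X = mat (dim_row X) (dim_col X)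
     (\<lambda>(i, j). \<Sum>k. (X ^\<^sub>m k) $$ (i, j) / of_nat (fact k))"

text \<open>Block-diagonal subgroup of U(n) with respect to a partition of the index
  set {0..<n} given by a block-labelling function blk.\<close>
definition block_subgroup :: "nat \<Rightarrow> (nat \<Rightarrow> nat) \<Rightarrow> complex mat set" where
  "block_subgroup n blk = {A \<in> unitary_group n.
      \<forall>i<n. \<forall>j<n. blk i \<noteq> blk j \<longrightarrow> A $$ (i, j) = 0}"

definition blk3 :: "nat \<Rightarrow> nat \<Rightarrow> nat \<Rightarrow> nat" where
  "blk3 n1 n2 i = (if i < n1 then 0 else if i < n1 + n2 then 1 else 2)"

definition blk2 :: "nat \<Rightarrow> nat \<Rightarrow> nat" where
  "blk2 p i = (if i < p then 0 else 1)"

definition skew :: "nat \<Rightarrow> nat \<Rightarrow> nat \<Rightarrow> complex mat" where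
  "skew n i j = matunit n i j - matunit n j i"

definition rspan2 :: "complex mat \<Rightarrow> complex mat \<Rightarrow> complex mat set" where
  "rspan2 X Y = {complex_of_real s \<cdot>\<^sub>m X + complex_of_real t \<cdot>\<^sub>m Y | s t. True}"

definition rspan1 :: "complex mat \<Rightarrow> complex mat set" where
  "rspan1 X = {complex_of_real s \<cdot>\<^sub>m X | s. True}"

end

theory Submission
  imports Defs "HOL-Analysis.L2_Norm"
begin

text \<open>Modulo \<open>H\<close>, an element of \<open>U(n)\<close> is the plane spanned by its first two columns. Modulo \<open>L\<close>, a basis
  of this plane is determined by its three \<open>2 \<times> 2\<close> Gram matrices, one for each block, which sum to the identity.
  A unitary change of basis of the plane makes the first Gram matrix diagonal and the
  second one real; the third is then real as well. Such triples depend on five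
  real parameters, and the five angles of \<open>B = A\<^sub>2 A' A\<^sub>1\<close> can be solved for explicitly.\<close>

text \<open>Multiplying one basis vector of the plane by a phase keeps the first Gram matrix
  diagonal and rotates the off-diagonal entry of the second, so this freedom can be spent on making
  that entry a real number \<open>v\<close>. The columns of a unitary matrix are orthogonal, hence
  the off-diagonal entry in the third block is \<open>-v\<close>. The five parameters are the two
  diagonal entries in the first block and the three entries of the real symmetric matrix in the
  second. The factor \<open>A'\<close> is what produces \<open>v\<close>: at angle 0 the first two
  columns of an element of \<open>B\<close> are orthogonal in every block, and only its rotation
  mixes a component parallel to the first column into the second one. The six coordinates moved by
  \<open>B\<close> lie two in each block, which is the room that two vectors with an arbitrary Gram
  matrix require; this is where all blocks having size at least 2 enters. The remaining difficulty
  is degeneracy: lengths may vanish, so angles are always obtained from a sum of squares and never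
  from a quotient.\<close>

section \<open>Adjoints, unitary matrices and block subgroups\<close>

lemma mat_adjoint_dim [simp]: "dim_row (mat_adjoint A) = dim_col A" "dim_col (mat_adjoint A) = dim_row A"
  unfolding mat_adjoint_def by simp_all

lemma mat_adjoint_carrier [simp]: "A \<in> carrier_mat n m \<Longrightarrow> mat_adjoint A \<in> carrier_mat m n"
  by (rule carrier_matI) simp_all

lemma mat_adjoint_index:
  fixes A :: "complex mat"
  assumes "A \<in> carrier_mat n m" "i < m" "j < n"
  shows "mat_adjoint A $$ (i, j) = cnj (A $$ (j, i))"
  using assms unfolding mat_adjoint_def by (simp add: mat_of_rows_index)

lemma mat_mult_index_sum:
  fixes A B :: "'a :: comm_semiring_0 mat"
  assumes "A \<in> carrier_mat n m" "B \<in> carrier_mat m k" "i < n" "j < k"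
  shows "(A * B) $$ (i, j) = (\<Sum>r<m. A $$ (i, r) * B $$ (r, j))"
  using assms by (simp add: scalar_prod_def atLeast0LessThan)

lemma mat_vec_index_sum:
  fixes A :: "'a :: comm_semiring_0 mat"
  assumes "A \<in> carrier_mat n m" "v \<in> carrier_vec m" "i < n"
  shows "(A *\<^sub>v v) $ i = (\<Sum>r<m. A $$ (i, r) * v $ r)"
  using assms by (simp add: scalar_prod_def atLeast0LessThan)

lemma mat_adjoint_adjoint:
  fixes A :: "complex mat"
  assumes "A \<in> carrier_mat n m"
  shows "mat_adjoint (mat_adjoint A) = A"
proof (rule eq_matI)
  fix i j assume "i < dim_row A" "j < dim_col A"
  then have ij: "i < n" "j < m" using assms by auto
  show "mat_adjoint (mat_adjoint A) $$ (i, j) = A $$ (i, j)"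
    unfolding mat_adjoint_index[OF mat_adjoint_carrier[OF assms] ij] mat_adjoint_index[OF assms ij(2,1)]
    by simp
qed simp_all

lemma mat_adjoint_mult:
  fixes A B :: "complex mat"
  assumes A: "A \<in> carrier_mat n m" and B: "B \<in> carrier_mat m k"
  shows "mat_adjoint (A * B) = mat_adjoint B * mat_adjoint A"
proof (rule eq_matI)
  have AB: "A * B \<in> carrier_mat n k" using A B by simp
  have aA: "mat_adjoint A \<in> carrier_mat m n" and aB: "mat_adjoint B \<in> carrier_mat k m"
    using A B by simp_all
  show "dim_row (mat_adjoint (A * B)) = dim_row (mat_adjoint B * mat_adjoint A)"
    "dim_col (mat_adjoint (A * B)) = dim_col (mat_adjoint B * mat_adjoint A)"
    using mat_adjoint_carrier[OF AB] aA aB by auto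
  fix i j assume "i < dim_row (mat_adjoint B * mat_adjoint A)" "j < dim_col (mat_adjoint B * mat_adjoint A)"
  then have ij: "i < k" "j < n" using aA aB by auto
  show "mat_adjoint (A * B) $$ (i, j) = (mat_adjoint B * mat_adjoint A) $$ (i, j)"
    unfolding mat_adjoint_index[OF AB ij] mat_mult_index_sum[OF A B ij(2,1)]
      mat_mult_index_sum[OF aB aA ij]
    using A B ij by (simp add: mat_adjoint_index mult.commute)
qed

lemma unitary_group_iff:
  "A \<in> unitary_group n \<longleftrightarrow> A \<in> carrier_mat n n \<and>
     (\<forall>i<n. \<forall>j<n. (\<Sum>r<n. cnj (A $$ (r, i)) * A $$ (r, j)) = of_bool (i = j))"
proof -
  have "mat_adjoint A * A = 1\<^sub>m n \<longleftrightarrow>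
     (\<forall>i<n. \<forall>j<n. (\<Sum>r<n. cnj (A $$ (r, i)) * A $$ (r, j)) = of_bool (i = j))"
    if A: "A \<in> carrier_mat n n"
  proof -
    have aA: "mat_adjoint A \<in> carrier_mat n n" using A by simp
    have "mat_adjoint A * A = 1\<^sub>m n \<longleftrightarrow>
        (\<forall>i<n. \<forall>j<n. (mat_adjoint A * A) $$ (i, j) = (1\<^sub>m n :: complex mat) $$ (i, j))"
      using aA A by (auto simp: mat_eq_iff simp del: index_mult_mat(1))
    also have "\<dots> \<longleftrightarrow> (\<forall>i<n. \<forall>j<n. (\<Sum>r<n. cnj (A $$ (r, i)) * A $$ (r, j)) = of_bool (i = j))"
      using A by (simp add: mat_mult_index_sum[OF aA A] mat_adjoint_index of_bool_def del: index_mult_mat(1))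
    finally show ?thesis .
  qed
  then show ?thesis unfolding unitary_group_def by blast
qed

lemma unitary_group_carrier: "A \<in> unitary_group n \<Longrightarrow> A \<in> carrier_mat n n"
  by (simp add: unitary_group_def)

lemma unitary_group_left_inv: "A \<in> unitary_group n \<Longrightarrow> mat_adjoint A * A = 1\<^sub>m n"
  by (simp add: unitary_group_def)

lemma unitary_group_right_inv: "A \<in> unitary_group n \<Longrightarrow> A * mat_adjoint A = 1\<^sub>m n"
  by (rule mat_mult_left_right_inverse[where n = n])
    (simp_all add: unitary_group_carrier unitary_group_left_inv)

lemma unitary_group_adjoint:
  assumes "A \<in> unitary_group n"
  shows "mat_adjoint A \<in> unitary_group n"
  using unitary_group_right_inv[OF assms] mat_adjoint_carrier[OF unitary_group_carrier[OF assms]]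
  by (simp add: unitary_group_def mat_adjoint_adjoint[OF unitary_group_carrier[OF assms]])

lemma unitary_group_mult:
  assumes A: "A \<in> unitary_group n" and B: "B \<in> unitary_group n"
  shows "A * B \<in> unitary_group n"
proof -
  note c = unitary_group_carrier[OF A] unitary_group_carrier[OF B]
  note d = mat_adjoint_carrier[OF c(1)] mat_adjoint_carrier[OF c(2)]
  have "mat_adjoint (A * B) * (A * B) = mat_adjoint B * ((mat_adjoint A * A) * B)"
    unfolding mat_adjoint_mult[OF c] using c d
    by (simp add: assoc_mult_mat[of _ n n _ n _ n])
  also have "\<dots> = 1\<^sub>m n"
    using c unitary_group_left_inv[OF A] unitary_group_left_inv[OF B] by simp
  finally show ?thesis using c by (simp add: unitary_group_def)
qed

lemma block_subgroup_mult:
  assumes A: "A \<in> block_subgroup n blk" and B: "B \<in> block_subgroup n blk"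
  shows "A * B \<in> block_subgroup n blk"
proof -
  have c: "A \<in> carrier_mat n n" "B \<in> carrier_mat n n"
    using A B by (auto simp: block_subgroup_def unitary_group_def)
  have "(A * B) $$ (i, j) = 0" if ij: "i < n" "j < n" "blk i \<noteq> blk j" for i j
    unfolding mat_mult_index_sum[OF c ij(1,2)]
  proof (rule sum.neutral, rule ballI)
    fix r assume "r \<in> {..<n}"
    then show "A $$ (i, r) * B $$ (r, j) = 0"
      using A B ij by (cases "blk i = blk r") (auto simp: block_subgroup_def)
  qed
  then show ?thesis
    using A B by (auto simp: block_subgroup_def intro: unitary_group_mult)
qed

lemma block_subgroup_adjoint:
  assumes "A \<in> block_subgroup n blk"
  shows "mat_adjoint A \<in> block_subgroup n blk"
proof -
  have A: "A \<in> unitary_group n" using assms by (simp add: block_subgroup_def)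
  then have "mat_adjoint A $$ (i, j) = 0" if "i < n" "j < n" "blk i \<noteq> blk j" for i j
    using mat_adjoint_index[OF unitary_group_carrier[OF A] that(1,2)] assms that
    by (simp add: block_subgroup_def)
  then show ?thesis using unitary_group_adjoint[OF A] by (simp add: block_subgroup_def)
qed

section \<open>Blockwise inner products as a complete invariant of a block subgroup\<close>

text \<open>Antilinear in the first argument. Vectors keep all \<open>n\<close> coordinates instead
  of being cut into pieces, so the constant labelling yields the ordinary inner product as a special
  case, and a label that does not occur yields 0.\<close>

definition block_inner :: "nat \<Rightarrow> (nat \<Rightarrow> nat) \<Rightarrow> nat \<Rightarrow> complex vec \<Rightarrow> complex vec \<Rightarrow> complex" where
  "block_inner n blk k v w = (\<Sum>i | i < n \<and> blk i = k. cnj (v $ i) * w $ i)"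

lemma block_inner_add:
  assumes "v \<in> carrier_vec n" "w \<in> carrier_vec n"
  shows "block_inner n blk k u (v + w) = block_inner n blk k u v + block_inner n blk k u w"
    "block_inner n blk k (v + w) u = block_inner n blk k v u + block_inner n blk k w u"
  using assms by (simp_all add: block_inner_def sum.distrib ring_distribs)

lemma block_inner_minus:
  assumes "v \<in> carrier_vec n" "w \<in> carrier_vec n"
  shows "block_inner n blk k u (v - w) = block_inner n blk k u v - block_inner n blk k u w"
    "block_inner n blk k (v - w) u = block_inner n blk k v u - block_inner n blk k w u"
  using assms by (simp_all add: block_inner_def sum_subtractf ring_distribs)

lemma block_inner_smult:
  assumes "v \<in> carrier_vec n"
  shows "block_inner n blk k u (c \<cdot>\<^sub>v v) = c * block_inner n blk k u v"
    "block_inner n blk k (c \<cdot>\<^sub>v v) u = cnj c * block_inner n blk k v u"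
  using assms by (simp_all add: block_inner_def sum_distrib_left mult_ac)

lemma cnj_block_inner: "cnj (block_inner n blk k v w) = block_inner n blk k w v"
  by (simp add: block_inner_def mult.commute)

lemma block_inner_self: "block_inner n blk k v v = of_real (\<Sum>i | i < n \<and> blk i = k. (cmod (v $ i))\<^sup>2)"
  unfolding block_inner_def of_real_sum
  by (rule sum.cong) (simp_all add: complex_norm_square mult.commute del: of_real_power)

lemma block_inner_self_eq_0:
  assumes "block_inner n blk k v v = 0" "i < n" "blk i = k"
  shows "v $ i = 0"
proof -
  have "(\<Sum>i | i < n \<and> blk i = k. (cmod (v $ i))\<^sup>2) = 0"
    using assms(1) unfolding block_inner_self of_real_eq_0_iff .
  then show ?thesis
    using assms(2,3) by (subst (asm) sum_nonneg_eq_0_iff) auto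
qed

text \<open>Applied to the reduced basis, this bounds the off-diagonal Gram entry and so keeps the
  remainders \<open>r1\<close> and \<open>r2\<close> in \<open>gram_angles\<close>
  nonnegative.\<close>

lemma block_inner_Cauchy_Schwarz:
  "(cmod (block_inner n blk k v w))\<^sup>2 \<le> Re (block_inner n blk k v v) * Re (block_inner n blk k w w)"
proof -
  let ?K = "{i. i < n \<and> blk i = k}"
  have "cmod (block_inner n blk k v w) \<le> (\<Sum>i\<in>?K. \<bar>cmod (v $ i)\<bar> * \<bar>cmod (w $ i)\<bar>)"
    unfolding block_inner_def by (rule order_trans[OF norm_sum]) (simp add: norm_mult)
  also have "\<dots> \<le> L2_set (\<lambda>i. cmod (v $ i)) ?K * L2_set (\<lambda>i. cmod (w $ i)) ?K"
    by (rule L2_set_mult_ineq)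
  finally have "(cmod (block_inner n blk k v w))\<^sup>2
      \<le> (L2_set (\<lambda>i. cmod (v $ i)) ?K * L2_set (\<lambda>i. cmod (w $ i)) ?K)\<^sup>2"
    by (intro power_mono) auto
  also have "\<dots> = Re (block_inner n blk k v v) * Re (block_inner n blk k w w)"
    unfolding block_inner_self by (simp add: power_mult_distrib L2_set_def sum_nonneg)
  finally show ?thesis .
qed

text \<open>The diagonal block of \<open>l\<close> with label \<open>k\<close> is itself unitary:
  two columns from that block vanish in all rows outside it, so their orthonormality survives the
  restriction to the rows of the block.\<close>

lemma block_subgroup_preserves_block_inner:
  assumes l: "l \<in> block_subgroup n blk" and v: "v \<in> carrier_vec n" and w: "w \<in> carrier_vec n"
  shows "block_inner n blk k (l *\<^sub>v v) (l *\<^sub>v w) = block_inner n blk k v w"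
proof -
  let ?K = "{i. i < n \<and> blk i = k}"
  have c: "l \<in> carrier_mat n n" and z: "\<And>i j. i < n \<Longrightarrow> j < n \<Longrightarrow> blk i \<noteq> blk j \<Longrightarrow> l $$ (i, j) = 0"
    and u: "\<And>i j. i < n \<Longrightarrow> j < n \<Longrightarrow> (\<Sum>r<n. cnj (l $$ (r, i)) * l $$ (r, j)) = of_bool (i = j)"
    using l unfolding block_subgroup_def unitary_group_iff by blast+
  have mv: "(l *\<^sub>v x) $ r = (\<Sum>i\<in>?K. l $$ (r, i) * x $ i)"
    if "r \<in> ?K" "x \<in> carrier_vec n" for r x
    unfolding mat_vec_index_sum[OF c that(2) conjunct1[OF that(1)[simplified]]]
    by (rule sum.mono_neutral_right) (use that in \<open>auto intro!: z\<close>)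
  have uK: "(\<Sum>r\<in>?K. cnj (l $$ (r, i)) * l $$ (r, j)) = of_bool (i = j)"
    if "i \<in> ?K" "j \<in> ?K" for i j
  proof -
    have "(\<Sum>r\<in>?K. cnj (l $$ (r, i)) * l $$ (r, j)) = (\<Sum>r<n. cnj (l $$ (r, i)) * l $$ (r, j))"
      by (rule sum.mono_neutral_left) (use that in \<open>auto intro!: z\<close>)
    then show ?thesis using u that by simp
  qed
  have "block_inner n blk k (l *\<^sub>v v) (l *\<^sub>v w)
      = (\<Sum>r\<in>?K. cnj (\<Sum>i\<in>?K. l $$ (r, i) * v $ i) * (\<Sum>j\<in>?K. l $$ (r, j) * w $ j))"
    unfolding block_inner_def by (intro sum.cong refl) (simp add: mv v w)
  also have "\<dots> = (\<Sum>r\<in>?K. \<Sum>i\<in>?K. \<Sum>j\<in>?K.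
      cnj (v $ i) * w $ j * (cnj (l $$ (r, i)) * l $$ (r, j)))"
    unfolding cnj_sum sum_product by (intro sum.cong refl) (simp add: mult_ac)
  also have "\<dots> = (\<Sum>i\<in>?K. \<Sum>r\<in>?K. \<Sum>j\<in>?K.
      cnj (v $ i) * w $ j * (cnj (l $$ (r, i)) * l $$ (r, j)))"
    by (rule sum.swap)
  also have "\<dots> = (\<Sum>i\<in>?K. \<Sum>j\<in>?K. \<Sum>r\<in>?K.
      cnj (v $ i) * w $ j * (cnj (l $$ (r, i)) * l $$ (r, j)))"
    by (intro sum.cong refl sum.swap)
  also have "\<dots> = (\<Sum>i\<in>?K. \<Sum>j\<in>?K. cnj (v $ i) * w $ j * of_bool (i = j))"
    unfolding sum_distrib_left[symmetric] by (intro sum.cong refl) (simp only: uK)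
  also have "\<dots> = (\<Sum>i\<in>?K. cnj (v $ i) * w $ i)"
    by (intro sum.cong refl) (simp add: of_bool_def if_distrib cong: if_cong)
  finally show ?thesis unfolding block_inner_def .
qed

text \<open>In every block the matrix is the complex reflection \<open>1 - w w\<^sup>* / \<langle>w, a\<rangle>\<close> with \<open>w = a - c\<close>.
  It is unitary because \<open>2 Re \<langle>w, a\<rangle> = \<langle>w, w\<rangle>\<close>; if \<open>w\<close> vanishes on the block, then \<open>1 / 0 = 0\<close>
  makes it the identity there.\<close>
lemma block_reflection:
  assumes a: "a \<in> carrier_vec n" and c: "c \<in> carrier_vec n"
    and eq: "\<And>k. block_inner n blk k a a = block_inner n blk k c c"
  obtains l where "l \<in> block_subgroup n blk" "l *\<^sub>v a = c"
    "\<And>x. x \<in> carrier_vec n \<Longrightarrow> (\<And>k. block_inner n blk k (a - c) x = 0) \<Longrightarrow> l *\<^sub>v x = x"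
proof -
  define w where "w = a - c"
  have w: "w \<in> carrier_vec n" using a c by (simp add: w_def)
  define D where "D k = block_inner n blk k w a" for k
  define N where "N k = block_inner n blk k w w" for k
  define \<tau> where "\<tau> k = 1 / D k" for k
  define l where "l = mat n n (\<lambda>(i, j). of_bool (i = j) -
     (if blk i = blk j then \<tau> (blk i) * w $ i * cnj (w $ j) else 0))"
  have lc: "l \<in> carrier_mat n n" by (simp add: l_def)
  have ND: "N k = D k + cnj (D k)" for k
    unfolding N_def D_def w_def cnj_block_inner using a c
    by (simp add: block_inner_minus eq)
  \<comment> \<open>Expanding the adjoint of \<open>1 - \<tau> w w^*\<close> times itself gives
    \<open>1 - (\<tau> + cnj \<tau> - cnj \<tau> * \<tau> * N) w w^*\<close>, so this identity is
    exactly unitarity on a block.\<close>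
  have tau: "\<tau> k + cnj (\<tau> k) = cnj (\<tau> k) * \<tau> k * N k" for k
    unfolding ND \<tau>_def by (cases "D k = 0") (simp_all add: field_simps)
  have lx: "(l *\<^sub>v x) $ i = x $ i - \<tau> (blk i) * w $ i * block_inner n blk (blk i) w x"
    if i: "i < n" and x: "x \<in> carrier_vec n" for i x
  proof -
    have "(l *\<^sub>v x) $ i = (\<Sum>r<n. (if r = i then x $ r else 0) -
        (if blk r = blk i then \<tau> (blk i) * w $ i * (cnj (w $ r) * x $ r) else 0))"
      unfolding mat_vec_index_sum[OF lc x i]
      by (rule sum.cong) (use i in \<open>auto simp: l_def algebra_simps\<close>)
    also have "\<dots> = x $ i - (\<Sum>r\<in>{r\<in>{..<n}. blk r = blk i}. \<tau> (blk i) * w $ i * (cnj (w $ r) * x $ r))"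
      using i by (subst sum.inter_filter) (simp_all add: sum_subtractf)
    finally show ?thesis by (simp add: block_inner_def sum_distrib_left)
  qed
  have "l \<in> unitary_group n"
    unfolding unitary_group_iff
  proof (intro conjI allI impI lc)
    fix i j assume i: "i < n" and j: "j < n"
    \<comment> \<open>The correction terms survive only if \<open>i\<close> and \<open>j\<close>
      share a block; then both columns carry the same factor, which may be written with
      \<open>blk i\<close> throughout.\<close>
    let ?s = "if blk i = blk j then 1 else 0 :: complex"
    have "(\<Sum>r<n. cnj (l $$ (r, i)) * l $$ (r, j)) =
      (\<Sum>r<n. (if r = i then of_bool (i = j) else 0)
         - (if r = i then ?s * \<tau> (blk i) * w $ i * cnj (w $ j) else 0)
         - (if r = j then ?s * cnj (\<tau> (blk i)) * w $ i * cnj (w $ j) else 0)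
         + (if blk r = blk i then ?s * cnj (\<tau> (blk i)) * \<tau> (blk i) * w $ i * cnj (w $ j) *
              (cnj (w $ r) * w $ r) else 0))"
      by (rule sum.cong) (use i j in \<open>auto simp: l_def algebra_simps\<close>)
    also have "\<dots> = of_bool (i = j) - ?s * \<tau> (blk i) * w $ i * cnj (w $ j)
         - ?s * cnj (\<tau> (blk i)) * w $ i * cnj (w $ j)
         + (\<Sum>r\<in>{r\<in>{..<n}. blk r = blk i}. ?s * cnj (\<tau> (blk i)) * \<tau> (blk i) * w $ i * cnj (w $ j) *
              (cnj (w $ r) * w $ r))"
      using i j
      by (subst sum.inter_filter)
        (simp_all add: sum_subtractf sum.distrib del: if_split)
    also have "\<dots> = of_bool (i = j) - ?s * w $ i * cnj (w $ j) *
        (\<tau> (blk i) + cnj (\<tau> (blk i)) - cnj (\<tau> (blk i)) * \<tau> (blk i) * N (blk i))"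
      unfolding sum_distrib_left[symmetric] by (simp add: N_def block_inner_def algebra_simps)
    finally show "(\<Sum>r<n. cnj (l $$ (r, i)) * l $$ (r, j)) = of_bool (i = j)"
      by (simp add: tau)
  qed
  then have "l \<in> block_subgroup n blk"
    by (auto simp: block_subgroup_def l_def)
  moreover have "l *\<^sub>v a = c"
  proof (rule eq_vecI)
    fix i assume "i < dim_vec c"
    then have i: "i < n" using c by simp
    \<comment> \<open>A vanishing denominator forces \<open>N = 0\<close> on the block, so
      \<open>a\<close> and \<open>c\<close> already agree there and the identity is the right
      choice.\<close>
    have "w $ i = 0" if "D (blk i) = 0"
      using block_inner_self_eq_0[of n blk "blk i" w i] ND[of "blk i"] that i by (simp add: N_def)
    then have "(l *\<^sub>v a) $ i = a $ i - w $ i"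
      unfolding lx[OF i a] D_def[symmetric] by (cases "D (blk i) = 0") (simp_all add: \<tau>_def)
    then show "(l *\<^sub>v a) $ i = c $ i" using i a c by (simp add: w_def)
  qed (use lc c in auto)
  moreover have "l *\<^sub>v x = x"
    if x: "x \<in> carrier_vec n" and z: "\<And>k. block_inner n blk k (a - c) x = 0" for x
    by (rule eq_vecI) (use lc x z in \<open>auto simp: lx w_def simp del: index_mult_mat_vec\<close>)
  ultimately show ?thesis by (rule that)
qed

text \<open>The second reflection fixes \<open>c\<close>, because \<open>l a = c\<close> already forces \<open>l b - d\<close> to be
  blockwise orthogonal to \<open>c\<close>.\<close>
lemma block_subgroup_transitive:
  assumes ab: "a \<in> carrier_vec n" "b \<in> carrier_vec n" and cd: "c \<in> carrier_vec n" "d \<in> carrier_vec n"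
    and eq: "\<And>k. block_inner n blk k a a = block_inner n blk k c c"
      "\<And>k. block_inner n blk k a b = block_inner n blk k c d"
      "\<And>k. block_inner n blk k b b = block_inner n blk k d d"
  obtains l where "l \<in> block_subgroup n blk" "l *\<^sub>v a = c" "l *\<^sub>v b = d"
proof -
  obtain l where l: "l \<in> block_subgroup n blk" "l *\<^sub>v a = c"
    using block_reflection[OF ab(1) cd(1) eq(1)] by blast
  have lc: "l \<in> carrier_mat n n" using l by (simp add: block_subgroup_def unitary_group_carrier)
  have lb: "l *\<^sub>v b \<in> carrier_vec n" using lc ab by simp
  have "block_inner n blk k (l *\<^sub>v b) (l *\<^sub>v b) = block_inner n blk k d d" for k
    using block_subgroup_preserves_block_inner[OF l(1)] ab eq by simp
  then obtain m where m: "m \<in> block_subgroup n blk" "m *\<^sub>v (l *\<^sub>v b) = d"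
    "\<And>x. x \<in> carrier_vec n \<Longrightarrow> (\<And>k. block_inner n blk k (l *\<^sub>v b - d) x = 0) \<Longrightarrow> m *\<^sub>v x = x"
    using block_reflection[OF lb cd(2)] by blast
  have "block_inner n blk k c (l *\<^sub>v b - d) = 0" for k
    using block_subgroup_preserves_block_inner[OF l(1) ab, of k] l(2) lb cd eq(2)
    by (simp add: block_inner_minus)
  then have "block_inner n blk k (l *\<^sub>v b - d) c = 0" for k
    using cnj_block_inner[of n blk k c "l *\<^sub>v b - d"] by simp
  then have "m *\<^sub>v c = c" using m(3) cd by blast
  moreover have mc: "m \<in> carrier_mat n n" using m by (simp add: block_subgroup_def unitary_group_carrier)
  ultimately show ?thesis
    using that[OF block_subgroup_mult[OF m(1) l(1)]] l(2) m(2)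
    by (simp add: assoc_mult_mat_vec[OF mc lc] ab)
qed

section \<open>Exponentials of the generators as plane rotations\<close>

text \<open>For an involution \<open>\<sigma>\<close> with \<open>\<theta> \<circ> \<sigma> = - \<theta>\<close>, this is the exponential of the matrix whose
  only nonzero entries are \<open>\<theta> a\<close> at \<open>(a, \<sigma> a)\<close>: a product of commuting plane rotations.\<close>
definition rotation_mat :: "nat \<Rightarrow> (nat \<Rightarrow> nat) \<Rightarrow> (nat \<Rightarrow> real) \<Rightarrow> complex mat" where
  "rotation_mat n \<sigma> \<theta> = mat n n (\<lambda>(a, b).
     (if b = a then of_real (cos (\<theta> a)) else 0) + (if b = \<sigma> a then of_real (sin (\<theta> a)) else 0))"

text \<open>The square of the matrix is diagonal with entries \<open>- (\<theta> a)^2\<close>. Even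
  powers are therefore diagonal, odd powers are supported on the graph of \<open>\<sigma>\<close>,
  and the exponential series splits into a cosine and a sine series. At a fixed point of
  \<open>\<sigma>\<close> the hypothesis gives \<open>\<theta> a = 0\<close>, so adding the two
  conditional terms counts nothing twice.\<close>

lemma mat_exp_antisymmetric_involution:
  fixes \<sigma> :: "nat \<Rightarrow> nat" and \<theta> :: "nat \<Rightarrow> real"
  assumes \<sigma>: "\<And>a. a < n \<Longrightarrow> \<sigma> a < n" "\<And>a. a < n \<Longrightarrow> \<sigma> (\<sigma> a) = a"
    and \<theta>: "\<And>a. a < n \<Longrightarrow> \<theta> (\<sigma> a) = - \<theta> a"
  shows "mat_exp (mat n n (\<lambda>(a, b). if b = \<sigma> a then of_real (\<theta> a) else 0)) = rotation_mat n \<sigma> \<theta>"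
proof -
  let ?X = "mat n n (\<lambda>(a, b). if b = \<sigma> a then of_real (\<theta> a) else 0) :: complex mat"
  have X: "?X \<in> carrier_mat n n" by simp
  \<comment> \<open>\<open>fact m\<close> cancels the factorial inside \<open>cos_coeff\<close> and
    \<open>sin_coeff\<close>: \<open>f\<close> is a signed power of the angle for even
    \<open>m\<close>, \<open>g\<close> for odd \<open>m\<close>, and each is 0 otherwise.\<close>
  define f where "f m a = fact m * cos_coeff m * \<theta> a ^ m" for m a
  define g where "g m a = fact m * sin_coeff m * \<theta> a ^ m" for m a
  have pow: "(?X ^\<^sub>m m) $$ (a, b) =
      (if b = a then of_real (f m a) else 0) + (if b = \<sigma> a then of_real (g m a) else 0)"
    if "a < n" "b < n" for m a b
    using that
  proof (induction m arbitrary: a b)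
    case 0
    then show ?case by (simp add: f_def g_def)
  next
    case (Suc m)
    have Xm: "?X ^\<^sub>m m \<in> carrier_mat n n" by simp
    have "(?X ^\<^sub>m Suc m) $$ (a, b) = (\<Sum>r<n. (?X ^\<^sub>m m) $$ (a, r) * ?X $$ (r, b))"
      using mat_mult_index_sum[OF Xm X Suc.prems] by simp
    also have "\<dots> = (\<Sum>r<n. (if r = a then of_real (f m a) * ?X $$ (r, b) else 0)
        + (if r = \<sigma> a then of_real (g m a) * ?X $$ (r, b) else 0))"
      by (rule sum.cong) (use Suc in \<open>simp_all add: distrib_right\<close>)
    also have "\<dots> = of_real (f m a) * ?X $$ (a, b) + of_real (g m a) * ?X $$ (\<sigma> a, b)"
      using Suc.prems \<sigma>(1) by (simp add: sum.distrib)
    also have "\<dots> = (if b = a then - of_real (g m a * \<theta> a) else 0)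
        + (if b = \<sigma> a then of_real (f m a * \<theta> a) else 0)"
      using Suc.prems \<sigma> \<theta>[of a] by auto
    also have "- of_real (g m a * \<theta> a) = (of_real (f (Suc m) a) :: complex)"
      by (simp add: f_def g_def cos_coeff_Suc field_simps del: of_nat_Suc)
    also have "f m a * \<theta> a = g (Suc m) a"
      by (simp add: f_def g_def sin_coeff_Suc field_simps del: of_nat_Suc)
    finally show ?case .
  qed
  have cos: "(\<lambda>m. of_real (f m a / fact m)) sums (of_real (cos (\<theta> a)) :: complex)" for a
    using cos_converges[of "\<theta> a"] by (intro sums_of_real) (simp add: f_def)
  have sin: "(\<lambda>m. of_real (g m a / fact m)) sums (of_real (sin (\<theta> a)) :: complex)" for a
    using sin_converges[of "\<theta> a"] by (intro sums_of_real) (simp add: g_def)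
  have "(\<Sum>m. (?X ^\<^sub>m m) $$ (a, b) / of_nat (fact m)) =
      (if b = a then of_real (cos (\<theta> a)) else 0) + (if b = \<sigma> a then of_real (sin (\<theta> a)) else 0)"
    if ab: "a < n" "b < n" for a b
  proof (rule sums_unique[symmetric])
    have "(\<lambda>m. (if b = a then of_real (f m a / fact m) else 0)
        + (if b = \<sigma> a then of_real (g m a / fact m) else 0))
        sums ((if b = a then of_real (cos (\<theta> a)) else 0)
        + (if b = \<sigma> a then of_real (sin (\<theta> a)) else 0) :: complex)"
      by (intro sums_add) (simp_all add: cos[simplified] sin[simplified])
    then show "(\<lambda>m. (?X ^\<^sub>m m) $$ (a, b) / of_nat (fact m))
        sums ((if b = a then of_real (cos (\<theta> a)) else 0)
        + (if b = \<sigma> a then of_real (sin (\<theta> a)) else 0))"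
      by (rule back_subst[of "\<lambda>h. h sums _"]) (simp add: fun_eq_iff pow[OF ab] add_divide_distrib)
  qed
  then show ?thesis
    by (intro eq_matI) (simp_all add: mat_exp_def rotation_mat_def)
qed

lemma rotation_mat_unitary:
  assumes \<sigma>: "\<And>a. a < n \<Longrightarrow> \<sigma> a < n" "\<And>a. a < n \<Longrightarrow> \<sigma> (\<sigma> a) = a"
    and \<theta>: "\<And>a. a < n \<Longrightarrow> \<theta> (\<sigma> a) = - \<theta> a"
  shows "rotation_mat n \<sigma> \<theta> \<in> unitary_group n"
  unfolding unitary_group_iff
proof (intro conjI allI impI)
  let ?R = "rotation_mat n \<sigma> \<theta>"
  show "?R \<in> carrier_mat n n" by (simp add: rotation_mat_def)
  fix i j assume ij: "i < n" "j < n"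
  \<comment> \<open>Read down a column, the sine stands in row \<open>\<sigma> i\<close>, where the
    angle is \<open>- \<theta> i\<close>; hence the minus sign.\<close>
  have col: "cnj (?R $$ (r, i)) =
      (if r = i then of_real (cos (\<theta> i)) else 0) + (if r = \<sigma> i then - of_real (sin (\<theta> i)) else 0)"
    if "r < n" for r
  proof -
    have "i = \<sigma> r \<longleftrightarrow> r = \<sigma> i" using \<sigma> that ij by metis
    then show ?thesis using that ij \<theta>[of i] \<sigma> by (auto simp: rotation_mat_def)
  qed
  have "(\<Sum>r<n. cnj (?R $$ (r, i)) * ?R $$ (r, j)) =
      (\<Sum>r<n. (if r = i then of_real (cos (\<theta> i)) * ?R $$ (r, j) else 0)
        + (if r = \<sigma> i then - of_real (sin (\<theta> i)) * ?R $$ (r, j) else 0))"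
    by (rule sum.cong) (simp_all add: col distrib_right)
  also have "\<dots> = of_real (cos (\<theta> i)) * ?R $$ (i, j) - of_real (sin (\<theta> i)) * ?R $$ (\<sigma> i, j)"
    using ij \<sigma> by (simp add: sum.distrib)
  also have "\<dots> = (if j = i then of_real ((cos (\<theta> i))\<^sup>2 + (sin (\<theta> i))\<^sup>2) else 0)"
    using ij \<sigma> \<theta> unfolding of_real_add by (simp add: rotation_mat_def power2_eq_square algebra_simps)
  finally show "(\<Sum>r<n. cnj (?R $$ (r, i)) * ?R $$ (r, j)) = of_bool (i = j)"
    by (auto simp del: of_real_add)
qed

lemma rotation_mat_mult_vec:
  assumes "v \<in> carrier_vec n" "i < n" "\<sigma> i < n"
  shows "(rotation_mat n \<sigma> \<theta> *\<^sub>v v) $ i = of_real (cos (\<theta> i)) * v $ i + of_real (sin (\<theta> i)) * v $ (\<sigma> i)"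
proof -
  have c: "rotation_mat n \<sigma> \<theta> \<in> carrier_mat n n" by (simp add: rotation_mat_def)
  have "(rotation_mat n \<sigma> \<theta> *\<^sub>v v) $ i = (\<Sum>r<n. (if r = i then of_real (cos (\<theta> i)) * v $ r else 0)
      + (if r = \<sigma> i then of_real (sin (\<theta> i)) * v $ r else 0))"
    unfolding mat_vec_index_sum[OF c assms(1,2)]
    by (rule sum.cong) (use assms in \<open>simp_all add: rotation_mat_def distrib_right\<close>)
  then show ?thesis using assms by (simp add: sum.distrib)
qed

text \<open>Two disjoint index pairs cover all three factors of \<open>B\<close>: \<open>A1\<close>
  and \<open>A2\<close> rotate in two planes at once, and \<open>A'\<close> is the case in which the
  second angle is 0.\<close>

definition pair_swap :: "nat \<Rightarrow> nat \<Rightarrow> nat \<Rightarrow> nat \<Rightarrow> nat \<Rightarrow> nat" where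
  "pair_swap i j k l a = (if a = i then j else if a = j then i else if a = k then l else if a = l then k else a)"

definition pair_angle :: "nat \<Rightarrow> nat \<Rightarrow> nat \<Rightarrow> nat \<Rightarrow> real \<Rightarrow> real \<Rightarrow> nat \<Rightarrow> real" where
  "pair_angle i j k l s t a =
     (if a = i then s else if a = j then - s else if a = k then t else if a = l then - t else 0)"

context
  fixes n i j k l :: nat
  assumes lt: "i < n" "j < n" "k < n" "l < n" and distinct: "distinct [i, j, k, l]"
begin

lemma pair_swap_angle:
  assumes "a < n"
  shows "pair_swap i j k l a < n" "pair_swap i j k l (pair_swap i j k l a) = a"
    "pair_angle i j k l s t (pair_swap i j k l a) = - pair_angle i j k l s t a"
  using assms lt distinct by (auto simp: pair_swap_def pair_angle_def)

text \<open>\<open>skew\<close> counts indices from 1 and matrix entries from 0, whence the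
  successors.\<close>

lemma mat_exp_skew_pair:
  "mat_exp (of_real s \<cdot>\<^sub>m skew n (Suc i) (Suc j) + of_real t \<cdot>\<^sub>m skew n (Suc k) (Suc l))
     = rotation_mat n (pair_swap i j k l) (pair_angle i j k l s t)"
proof -
  have "of_real s \<cdot>\<^sub>m skew n (Suc i) (Suc j) + of_real t \<cdot>\<^sub>m skew n (Suc k) (Suc l)
      = mat n n (\<lambda>(a, b). if b = pair_swap i j k l a then of_real (pair_angle i j k l s t a) else 0)"
    by (rule eq_matI)
      (use distinct in \<open>auto simp: skew_def matunit_def pair_swap_def pair_angle_def\<close>)
  then show ?thesis
    by (simp add: mat_exp_antisymmetric_involution pair_swap_angle)
qed

lemma mat_exp_skew_pair_unitary:
  "mat_exp (of_real s \<cdot>\<^sub>m skew n (Suc i) (Suc j) + of_real t \<cdot>\<^sub>m skew n (Suc k) (Suc l)) \<in> unitary_group n"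
  unfolding mat_exp_skew_pair by (rule rotation_mat_unitary) (simp_all add: pair_swap_angle)

lemma mat_exp_skew_pair_mult_vec:
  fixes v :: "complex vec"
  assumes "v \<in> carrier_vec n" "a < n"
  shows "(mat_exp (of_real s \<cdot>\<^sub>m skew n (Suc i) (Suc j) + of_real t \<cdot>\<^sub>m skew n (Suc k) (Suc l)) *\<^sub>v v) $ a =
    (if a = i then of_real (cos s) * v $ i + of_real (sin s) * v $ j
     else if a = j then of_real (cos s) * v $ j - of_real (sin s) * v $ i
     else if a = k then of_real (cos t) * v $ k + of_real (sin t) * v $ l
     else if a = l then of_real (cos t) * v $ l - of_real (sin t) * v $ k
     else v $ a)"
  unfolding mat_exp_skew_pair
    rotation_mat_mult_vec[where \<sigma> = "pair_swap i j k l", OF assms pair_swap_angle(1)[OF assms(2)]]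
  using distinct by (auto simp: pair_swap_def pair_angle_def)

end

section \<open>Solving for the five angles\<close>

text \<open>Prescribing the radius lets a length found in one step serve as the radius of the next.
  \<open>polar_Ex\<close> may return the opposite sign, which a shift of the angle by
  \<open>pi\<close> absorbs; a zero radius needs no separate case.\<close>

lemma polar_with_radius:
  fixes x y R :: real
  assumes "R\<^sup>2 = x\<^sup>2 + y\<^sup>2"
  obtains \<phi> where "x = R * cos \<phi>" "y = R * sin \<phi>"
proof -
  obtain r \<phi> where r: "x = r * cos \<phi>" "y = r * sin \<phi>" using polar_Ex by blast
  then have "x\<^sup>2 + y\<^sup>2 = r\<^sup>2 * ((cos \<phi>)\<^sup>2 + (sin \<phi>)\<^sup>2)"
    by (simp only: power_mult_distrib distrib_left)
  then have "R\<^sup>2 = r\<^sup>2" using assms by simp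
  then consider "r = R" | "r = - R" by (metis power2_eq_iff)
  then show ?thesis
  proof cases
    case 1
    then show ?thesis using that r by blast
  next
    case 2
    then show ?thesis using that[of "\<phi> + pi"] r by simp
  qed
qed

text \<open>The equations say that the blockwise Gram matrices of the first two columns of \<open>x y z\<close> are
  prescribed. In the last two blocks, \<open>p\<close> is up to sign the length of the part of the second column
  that is blockwise parallel to the first one, and \<open>r1\<close>, \<open>r2\<close> are the squared lengths of
  the remaining parts. Division by zero is harmless: \<open>u1 u2 = 0\<close> forces \<open>v = 0\<close>.\<close>
lemma gram_angles:
  fixes u0 u1 u2 v w0 w1 w2 :: real
  assumes nonneg: "u0 \<ge> 0" "u1 \<ge> 0" "u2 \<ge> 0" "w0 \<ge> 0" "w1 \<ge> 0" "w2 \<ge> 0"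
    and sums: "u0 + u1 + u2 = 1" "w0 + w1 + w2 = 1"
    and CS: "v\<^sup>2 \<le> u1 * w1" "v\<^sup>2 \<le> u2 * w2"
  obtains s t a b \<theta> where
    "(cos s)\<^sup>2 = u0" "(sin s * sin a)\<^sup>2 = u1" "(sin s * cos a)\<^sup>2 = u2"
    "(cos t)\<^sup>2 = w0" "(sin t * sin \<theta> * cos a)\<^sup>2 + (sin t * cos \<theta> * sin b)\<^sup>2 = w1"
    "(sin t * sin \<theta> * sin a)\<^sup>2 + (sin t * cos \<theta> * cos b)\<^sup>2 = w2"
    "sin s * sin a * (sin t * sin \<theta> * cos a) = v"
proof -
  define S where "S = sqrt (u1 + u2)"
  define T where "T = sqrt (w1 + w2)"
  \<comment> \<open>In the second block the product of the first column with the parallel part of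
    the second must be \<open>v\<close>, that is \<open>sqrt u1 * p * cos a = v\<close>; the angle
    \<open>a\<close> will satisfy \<open>S * cos a = sqrt u2\<close>.\<close>
  define p where "p = v * S / (sqrt u1 * sqrt u2)"
  define r1 where "r1 = w1 - v\<^sup>2 / u1"
  define r2 where "r2 = w2 - v\<^sup>2 / u2"
  define c where "c = sqrt (r1 + r2)"
  have v0: "v = 0" if "u1 = 0 \<or> u2 = 0" using that CS by auto
  have r: "r1 \<ge> 0" "r2 \<ge> 0"
    using nonneg CS unfolding r1_def r2_def
    by (cases "u1 = 0", simp_all add: field_simps) (cases "u2 = 0", simp_all add: field_simps)
  have p2: "p\<^sup>2 = v\<^sup>2 / u1 + v\<^sup>2 / u2"
  proof (cases "u1 = 0 \<or> u2 = 0")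
    case True
    then show ?thesis using v0 by (simp add: p_def)
  next
    case False
    then show ?thesis using nonneg
      by (simp add: p_def S_def power_divide power_mult_distrib field_simps)
  qed
  \<comment> \<open>Nested polar coordinates: \<open>S\<close> and \<open>T\<close>, the lengths of
    the two columns outside the first block, become \<open>sin s\<close> and \<open>sin t\<close>.
    Then \<open>S\<close> is the radius for \<open>a\<close>, \<open>T\<close> the radius for
    \<open>\<theta>\<close> with legs \<open>c\<close> and \<open>p\<close>, and \<open>c\<close> in
    turn the radius for \<open>b\<close>.\<close>
  have S2: "S\<^sup>2 = (sqrt u2)\<^sup>2 + (sqrt u1)\<^sup>2" using nonneg by (simp add: S_def)
  have c2: "c\<^sup>2 = r1 + r2" using r by (simp add: c_def)
  have "1\<^sup>2 = (sqrt u0)\<^sup>2 + S\<^sup>2" using nonneg sums by (simp add: S_def)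
  then obtain s where s: "sqrt u0 = cos s" "S = sin s" by (elim polar_with_radius) simp
  have "1\<^sup>2 = (sqrt w0)\<^sup>2 + T\<^sup>2" using nonneg sums by (simp add: T_def)
  then obtain t where t: "sqrt w0 = cos t" "T = sin t" by (elim polar_with_radius) simp
  obtain a where a: "sqrt u2 = S * cos a" "sqrt u1 = S * sin a"
    using S2 by (elim polar_with_radius)
  have "T\<^sup>2 = c\<^sup>2 + p\<^sup>2" using nonneg by (simp add: T_def c2 p2 r1_def r2_def)
  then obtain \<theta> where \<theta>: "c = T * cos \<theta>" "p = T * sin \<theta>" by (elim polar_with_radius)
  have "c\<^sup>2 = (sqrt r2)\<^sup>2 + (sqrt r1)\<^sup>2" using r by (simp add: c2)
  then obtain b where b: "sqrt r2 = c * cos b" "sqrt r1 = c * sin b" by (elim polar_with_radius)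
  have "p * cos a = v * sqrt u2 / (sqrt u1 * sqrt u2)" "p * sin a = v * sqrt u1 / (sqrt u1 * sqrt u2)"
    by (simp_all add: p_def a)
  then have pa: "p * cos a = v / sqrt u1" "p * sin a = v / sqrt u2"
    using v0 by (cases "u1 = 0 \<or> u2 = 0"; auto)+
  show ?thesis
  proof (rule that[of s a t \<theta> b])
    show "(cos s)\<^sup>2 = u0" "(cos t)\<^sup>2 = w0" using nonneg by (simp_all flip: s t)
    show "(sin s * sin a)\<^sup>2 = u1" "(sin s * cos a)\<^sup>2 = u2" using nonneg by (simp_all flip: s a)
    have "(p * cos a)\<^sup>2 + (c * sin b)\<^sup>2 = w1"
      unfolding pa b[symmetric] using nonneg r by (simp add: power_divide r1_def)
    then show "(sin t * sin \<theta> * cos a)\<^sup>2 + (sin t * cos \<theta> * sin b)\<^sup>2 = w1"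
      by (simp add: \<theta> t)
    have "(p * sin a)\<^sup>2 + (c * cos b)\<^sup>2 = w2"
      unfolding pa b[symmetric] using nonneg r by (simp add: power_divide r2_def)
    then show "(sin t * sin \<theta> * sin a)\<^sup>2 + (sin t * cos \<theta> * cos b)\<^sup>2 = w2"
      by (simp add: \<theta> t)
    have "sqrt u1 * (p * cos a) = v" unfolding pa using v0 by auto
    then show "sin s * sin a * (sin t * sin \<theta> * cos a) = v" by (simp add: \<theta> t a s)
  qed
qed

section \<open>Normalising two Gram matrices by one unitary change of basis\<close>

text \<open>The quadratic formula gives a nonzero complex zero, and homogeneity of the form allows
  rescaling it to norm 1.\<close>

lemma binary_quadratic_form_isotropic:
  fixes A B C :: complex
  obtains x y where "cnj x * x + cnj y * y = 1" "A * x\<^sup>2 + B * x * y + C * y\<^sup>2 = 0"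
proof -
  obtain x y :: complex where xy: "x \<noteq> 0 \<or> y \<noteq> 0" "A * x\<^sup>2 + B * x * y + C * y\<^sup>2 = 0"
  proof (cases "A = 0")
    case True
    then show ?thesis using that[of 1 0] by simp
  next
    case False
    define d where "d = csqrt (B\<^sup>2 - 4 * A * C)"
    have d: "d\<^sup>2 = B\<^sup>2 - 4 * A * C" by (simp add: d_def)
    define x where "x = (d - B) / (2 * A)"
    have "4 * A * (A * x\<^sup>2 + B * x + C) = (2 * A * x + B)\<^sup>2 - (B\<^sup>2 - 4 * A * C)"
      by (simp add: power2_eq_square algebra_simps)
    also have "2 * A * x + B = d" using False by (simp add: x_def)
    finally have "A * x\<^sup>2 + B * x + C = 0" using False d by simp
    then show ?thesis using that[of x 1] by simp
  qed
  define N where "N = sqrt ((cmod x)\<^sup>2 + (cmod y)\<^sup>2)"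
  have "(cmod x)\<^sup>2 + (cmod y)\<^sup>2 > 0" using xy by (auto simp: add_pos_nonneg add_nonneg_pos)
  then have N: "N > 0" "N\<^sup>2 = (cmod x)\<^sup>2 + (cmod y)\<^sup>2" by (auto simp: N_def)
  let ?N = "of_real N :: complex"
  have "cnj x * x + cnj y * y = of_real (N\<^sup>2)"
    unfolding N(2) of_real_add complex_norm_square by (simp add: mult.commute)
  then have "cnj (x / ?N) * (x / ?N) + cnj (y / ?N) * (y / ?N) = 1"
    using N(1) by (simp add: power2_eq_square flip: add_divide_distrib)
  moreover have "A * (x / ?N)\<^sup>2 + B * (x / ?N) * (y / ?N) + C * (y / ?N)\<^sup>2
      = (A * x\<^sup>2 + B * x * y + C * y\<^sup>2) / ?N\<^sup>2"
    by (simp add: power_divide power2_eq_square add_divide_distrib)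
  ultimately show ?thesis
    by (intro that[of "x / ?N" "y / ?N"]) (simp_all only: xy(2) div_0)
qed

text \<open>Take \<open>(\<gamma>, \<delta>) = (-cnj \<beta>, cnj \<alpha>)\<close> up to a phase: the phase makes the second form real
  and the first one is a quadratic form in \<open>(cnj \<alpha>, cnj \<beta>)\<close>.\<close>
lemma simultaneous_unitary_reduction:
  fixes p11 p12 p21 p22 q11 q12 q21 q22 :: complex
  obtains \<alpha> \<beta> \<gamma> \<delta> where
    "cnj \<alpha> * \<alpha> + cnj \<beta> * \<beta> = 1" "cnj \<gamma> * \<gamma> + cnj \<delta> * \<delta> = 1" "cnj \<alpha> * \<gamma> + cnj \<beta> * \<delta> = 0"
    "cnj \<alpha> * \<gamma> * p11 + cnj \<alpha> * \<delta> * p12 + cnj \<beta> * \<gamma> * p21 + cnj \<beta> * \<delta> * p22 = 0"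
    "cnj \<alpha> * \<gamma> * q11 + cnj \<alpha> * \<delta> * q12 + cnj \<beta> * \<gamma> * q21 + cnj \<beta> * \<delta> * q22 \<in> \<real>"
proof -
  obtain x y where xy: "cnj x * x + cnj y * y = 1" "p12 * x\<^sup>2 + (p22 - p11) * x * y + (- p21) * y\<^sup>2 = 0"
    by (rule binary_quadratic_form_isotropic)
  define z where "z = - (x * y * q11) + x * x * q12 - y * y * q21 + y * x * q22"
  \<comment> \<open>\<open>z\<close> is the second form before the phase is inserted; multiplying by
    the conjugate phase of \<open>z\<close> turns it into \<open>cmod z\<close>.\<close>
  define \<mu> where "\<mu> = (if z = 0 then 1 else cnj z / of_real (cmod z))"
  have "cmod \<mu> = 1" by (simp add: \<mu>_def norm_divide)
  then have \<mu>: "cnj \<mu> * \<mu> = 1" using complex_norm_square[of \<mu>] by (simp add: mult.commute)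
  have "\<mu> * z \<in> \<real>"
  proof (cases "z = 0")
    case False
    then have "\<mu> * z = of_real ((cmod z)\<^sup>2) / of_real (cmod z)"
      by (simp add: \<mu>_def complex_norm_square mult.commute del: of_real_power)
    then show ?thesis by (metis Reals_divide Reals_of_real)
  qed simp
  show ?thesis
  proof (rule that[of "cnj x" "cnj y" "- \<mu> * y" "\<mu> * x"])
    have "cnj (- \<mu> * y) * (- \<mu> * y) + cnj (\<mu> * x) * (\<mu> * x) = (cnj \<mu> * \<mu>) * (cnj x * x + cnj y * y)"
      by (simp add: algebra_simps)
    then show "cnj (- \<mu> * y) * (- \<mu> * y) + cnj (\<mu> * x) * (\<mu> * x) = 1" by (simp add: \<mu> xy)
    show "cnj (cnj x) * cnj x + cnj (cnj y) * cnj y = 1" using xy(1) by (simp add: mult.commute)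
    show "cnj (cnj x) * (- \<mu> * y) + cnj (cnj y) * (\<mu> * x) = 0" by simp
    have "cnj (cnj x) * (- \<mu> * y) * p11 + cnj (cnj x) * (\<mu> * x) * p12 + cnj (cnj y) * (- \<mu> * y) * p21 +
        cnj (cnj y) * (\<mu> * x) * p22 = \<mu> * (p12 * x\<^sup>2 + (p22 - p11) * x * y + (- p21) * y\<^sup>2)"
      by (simp add: power2_eq_square algebra_simps)
    then show "cnj (cnj x) * (- \<mu> * y) * p11 + cnj (cnj x) * (\<mu> * x) * p12 + cnj (cnj y) * (- \<mu> * y) * p21 +
        cnj (cnj y) * (\<mu> * x) * p22 = 0" by (simp only: xy mult_zero_right)
    have "cnj (cnj x) * (- \<mu> * y) * q11 + cnj (cnj x) * (\<mu> * x) * q12 + cnj (cnj y) * (- \<mu> * y) * q21 +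
        cnj (cnj y) * (\<mu> * x) * q22 = \<mu> * z"
      by (simp add: z_def algebra_simps)
    then show "cnj (cnj x) * (- \<mu> * y) * q11 + cnj (cnj x) * (\<mu> * x) * q12 + cnj (cnj y) * (- \<mu> * y) * q21 +
        cnj (cnj y) * (\<mu> * x) * q22 \<in> \<real>" using \<open>\<mu> * z \<in> \<real>\<close> by simp
  qed
qed

section \<open>Gram matrices of combinations, sums over blocks, and membership in
  \<open>H\<close>\<close>

lemma block_inner_combination:
  assumes "v \<in> carrier_vec n" "w \<in> carrier_vec n"
  shows "block_inner n blk k (\<alpha> \<cdot>\<^sub>v v + \<beta> \<cdot>\<^sub>v w) (\<gamma> \<cdot>\<^sub>v v + \<delta> \<cdot>\<^sub>v w) =
    cnj \<alpha> * \<gamma> * block_inner n blk k v v + cnj \<alpha> * \<delta> * block_inner n blk k v w +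
    cnj \<beta> * \<gamma> * block_inner n blk k w v + cnj \<beta> * \<delta> * block_inner n blk k w w"
  using assms by (simp add: block_inner_add block_inner_smult algebra_simps)

lemma sum_block_inner:
  assumes "finite K" "\<And>i. i < n \<Longrightarrow> blk i \<in> K"
  shows "(\<Sum>k\<in>K. block_inner n blk k v w) = (\<Sum>i<n. cnj (v $ i) * w $ i)"
proof -
  have "(\<Sum>k\<in>K. block_inner n blk k v w) = (\<Sum>k\<in>K. \<Sum>i\<in>{i\<in>{..<n}. blk i = k}. cnj (v $ i) * w $ i)"
    by (simp add: block_inner_def)
  also have "\<dots> = (\<Sum>i<n. cnj (v $ i) * w $ i)"
    using assms by (intro sum.group) auto
  finally show ?thesis .
qed

lemma block_inner_support:
  assumes "\<And>i. i \<in> K \<Longrightarrow> i < n \<and> blk i = k"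
    and "\<And>i. i < n \<Longrightarrow> blk i = k \<Longrightarrow> i \<notin> K \<Longrightarrow> w $ i = 0"
  shows "block_inner n blk k v w = (\<Sum>i\<in>K. cnj (v $ i) * w $ i)"
  unfolding block_inner_def by (rule sum.mono_neutral_right) (use assms in auto)

text \<open>The first \<open>p\<close> columns and the first \<open>p\<close> rows have the same total squared norm \<open>p\<close>.\<close>
lemma unitary_block_triangular_imp_block_diagonal:
  assumes k: "k \<in> unitary_group n" and p: "p \<le> n"
    and z: "\<And>i j. p \<le> i \<Longrightarrow> i < n \<Longrightarrow> j < p \<Longrightarrow> k $$ (i, j) = 0"
  shows "k \<in> block_subgroup n (blk2 p)"
proof -
  let ?c = "\<lambda>i j. (cmod (k $$ (i, j)))\<^sup>2"
  have kc: "k \<in> carrier_mat n n" using k by (rule unitary_group_carrier)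
  have col: "(\<Sum>r<n. ?c r j) = 1" if "j < n" for j
  proof -
    have "of_real (\<Sum>r<n. ?c r j) = (\<Sum>r<n. cnj (k $$ (r, j)) * k $$ (r, j))"
      unfolding of_real_sum complex_norm_square by (simp add: mult.commute)
    also have "\<dots> = 1" using k that unfolding unitary_group_iff by simp
    finally show ?thesis by (metis of_real_eq_1_iff)
  qed
  have row: "(\<Sum>r<n. ?c i r) = 1" if "i < n" for i
  proof -
    have "of_real (\<Sum>r<n. ?c i r) = (\<Sum>r<n. cnj (mat_adjoint k $$ (r, i)) * mat_adjoint k $$ (r, i))"
      unfolding of_real_sum complex_norm_square using that by (simp add: mat_adjoint_index[OF kc])
    also have "\<dots> = 1" using unitary_group_adjoint[OF k] that unfolding unitary_group_iff by simp
    finally show ?thesis by (metis of_real_eq_1_iff)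
  qed
  have split: "{..<n} = {..<p} \<union> {p..<n}" using p by auto
  have "(\<Sum>j<p. \<Sum>r<p. ?c r j) = (\<Sum>j<p. \<Sum>r<n. ?c r j)"
    by (intro sum.cong refl sum.mono_neutral_left) (use p z in auto)
  also have "\<dots> = (\<Sum>j<p. \<Sum>r<n. ?c j r)" using col row p by simp
  also have "\<dots> = (\<Sum>j<p. \<Sum>r<p. ?c j r) + (\<Sum>j<p. \<Sum>r=p..<n. ?c j r)"
    unfolding split by (subst sum.union_disjoint) (auto simp: sum.distrib)
  also have "(\<Sum>j<p. \<Sum>r<p. ?c j r) = (\<Sum>j<p. \<Sum>r<p. ?c r j)" by (rule sum.swap)
  finally have "(\<Sum>j<p. \<Sum>r=p..<n. ?c j r) = 0" by simp
  then have "k $$ (i, j) = 0" if "i < p" "p \<le> j" "j < n" for i j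
    using that by (simp add: sum_nonneg_eq_0_iff sum_nonneg)
  then show ?thesis using k z p by (auto simp: block_subgroup_def blk2_def not_less)
qed

section \<open>The first two columns of elements of \<open>B\<close>, and the decomposition\<close>

lemma blk3_cases: "blk3 n1 n2 i \<in> {0, 1, 2}"
  by (simp add: blk3_def)

text \<open>Counted from 0, the last two coordinates are \<open>m\<close> and \<open>Suc m\<close>,
  and the bound on \<open>m\<close> keeps the six moved coordinates distinct. The two columns are
  followed through \<open>z\<close>, \<open>y\<close> and \<open>x\<close> in turn; the signs are
  those of rotations applied to unit vectors.\<close>

lemma rotation_product_columns:
  fixes n1 m n :: nat and s t a b \<theta> :: real
  assumes n1: "2 \<le> n1" and m: "n1 + 2 \<le> m" and n: "n = m + 2"
  defines "z \<equiv> mat_exp (of_real s \<cdot>\<^sub>m skew n 1 n + of_real t \<cdot>\<^sub>m skew n 2 (n - 1))"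
    and "y \<equiv> mat_exp (of_real \<theta> \<cdot>\<^sub>m skew n (n1 + 1) (n - 1))"
    and "x \<equiv> mat_exp (of_real a \<cdot>\<^sub>m skew n (n1 + 1) n + of_real b \<cdot>\<^sub>m skew n (n1 + 2) (n - 1))"
  shows "x \<in> unitary_group n" "y \<in> unitary_group n" "z \<in> unitary_group n"
    and "(x * y * z) *\<^sub>v unit_vec n 0 = vec n (\<lambda>i. of_real
      (if i = 0 then cos s else if i = n1 then - (sin s * sin a)
       else if i = Suc m then - (sin s * cos a) else 0))" (is ?c0)
    and "(x * y * z) *\<^sub>v unit_vec n 1 = vec n (\<lambda>i. of_real
      (if i = 1 then cos t else if i = n1 then - (sin t * sin \<theta> * cos a)
       else if i = Suc n1 then - (sin t * cos \<theta> * sin b)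
       else if i = m then - (sin t * cos \<theta> * cos b)
       else if i = Suc m then sin t * sin \<theta> * sin a else 0))" (is ?c1)
proof -
  have zd: "0 < n" "Suc m < n" "Suc 0 < n" "m < n" "distinct [0, Suc m, Suc 0, m]"
    and yd: "n1 < n" "m < n" "0 < n" "Suc 0 < n" "distinct [n1, m, 0, Suc 0]"
    and xd: "n1 < n" "Suc m < n" "Suc n1 < n" "m < n" "distinct [n1, Suc m, Suc n1, m]"
    using n1 m n by auto
  have z': "z = mat_exp (of_real s \<cdot>\<^sub>m skew n (Suc 0) (Suc (Suc m)) + of_real t \<cdot>\<^sub>m skew n (Suc (Suc 0)) (Suc m))"
    by (simp add: z_def n numeral_2_eq_2)
  have x': "x = mat_exp (of_real a \<cdot>\<^sub>m skew n (Suc n1) (Suc (Suc m)) + of_real b \<cdot>\<^sub>m skew n (Suc (Suc n1)) (Suc m))"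
    by (simp add: x_def n numeral_2_eq_2)
  \<comment> \<open>A zero rotation in the plane of coordinates 0 and 1 completes \<open>y\<close>
    to the two-pair form; \<open>2 \<le> n1\<close> keeps that plane disjoint from the one
    \<open>y\<close> rotates.\<close>
  have "of_real \<theta> \<cdot>\<^sub>m skew n (n1 + 1) (n - 1)
      = of_real \<theta> \<cdot>\<^sub>m skew n (Suc n1) (Suc m) + of_real 0 \<cdot>\<^sub>m skew n (Suc 0) (Suc (Suc 0))"
    by (rule eq_matI) (auto simp: n skew_def matunit_def)
  then have y': "y = mat_exp (of_real \<theta> \<cdot>\<^sub>m skew n (Suc n1) (Suc m) + of_real 0 \<cdot>\<^sub>m skew n (Suc 0) (Suc (Suc 0)))"
    by (simp only: y_def)
  show ux: "x \<in> unitary_group n" and uy: "y \<in> unitary_group n" and uz: "z \<in> unitary_group n"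
    unfolding x' y' z' by (rule mat_exp_skew_pair_unitary[OF xd] mat_exp_skew_pair_unitary[OF yd]
      mat_exp_skew_pair_unitary[OF zd])+
  note c = unitary_group_carrier[OF ux] unitary_group_carrier[OF uy] unitary_group_carrier[OF uz]
  note xv = mat_exp_skew_pair_mult_vec[OF xd, of _ _ a b, folded x']
    and yv = mat_exp_skew_pair_mult_vec[OF yd, of _ _ \<theta> 0, folded y']
    and zv = mat_exp_skew_pair_mult_vec[OF zd, of _ _ s t, folded z']
  have assoc: "(x * y * z) *\<^sub>v v = x *\<^sub>v (y *\<^sub>v (z *\<^sub>v v))" if "v \<in> carrier_vec n" for v
    using that c by (simp add: assoc_mult_mat_vec[of _ n n _ n])
  have z0: "z *\<^sub>v unit_vec n 0 = vec n (\<lambda>i. of_real (if i = 0 then cos s else if i = Suc m then - sin s else 0))"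
    by (rule eq_vecI) (use n1 m zd(1-4) c in \<open>auto simp: zv simp del: index_mult_mat_vec\<close>)
  \<comment> \<open>The first column of \<open>z\<close> lives on coordinates 0 and
    \<open>Suc m\<close>, while \<open>y\<close> moves only \<open>n1\<close> and
    \<open>m\<close>.\<close>
  have y0: "y *\<^sub>v (z *\<^sub>v unit_vec n 0) = z *\<^sub>v unit_vec n 0"
    unfolding z0
    by (rule eq_vecI) (use n1 m zd(1-4) c in \<open>auto simp: yv simp del: index_mult_mat_vec\<close>)
  have "x *\<^sub>v (z *\<^sub>v unit_vec n 0) = vec n (\<lambda>i. of_real
      (if i = 0 then cos s else if i = n1 then - (sin s * sin a)
       else if i = Suc m then - (sin s * cos a) else 0))"
    unfolding z0
    by (rule eq_vecI) (use n1 m zd(1-4) c in \<open>auto simp: xv simp del: index_mult_mat_vec\<close>)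
  then show ?c0 by (simp add: assoc y0)
  have z1: "z *\<^sub>v unit_vec n 1 = vec n (\<lambda>i. of_real (if i = 1 then cos t else if i = m then - sin t else 0))"
    by (rule eq_vecI) (use n1 m zd(1-4) c in \<open>auto simp: zv simp del: index_mult_mat_vec\<close>)
  have y1: "y *\<^sub>v (z *\<^sub>v unit_vec n 1) = vec n (\<lambda>i. of_real (if i = 1 then cos t
      else if i = n1 then - (sin t * sin \<theta>) else if i = m then - (sin t * cos \<theta>) else 0))"
    unfolding z1
    by (rule eq_vecI) (use n1 m zd(1-4) c in \<open>auto simp: yv simp del: index_mult_mat_vec\<close>)
  have "x *\<^sub>v (y *\<^sub>v (z *\<^sub>v unit_vec n 1)) = vec n (\<lambda>i. of_real
      (if i = 1 then cos t else if i = n1 then - (sin t * sin \<theta> * cos a)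
       else if i = Suc n1 then - (sin t * cos \<theta> * sin b)
       else if i = m then - (sin t * cos \<theta> * cos b)
       else if i = Suc m then sin t * sin \<theta> * sin a else 0))"
    unfolding y1
    by (rule eq_vecI) (use n1 m zd(1-4) c in \<open>auto simp: xv simp del: index_mult_mat_vec\<close>)
  then show ?c1 by (simp add: assoc)
qed

text \<open>Some \<open>l\<close> carries the reduced basis \<open>f1\<close>, \<open>f2\<close> of
  the plane of \<open>g\<close> to the first two columns of the rotation product \<open>M\<close>.
  Hence \<open>k = g^* l^* M\<close> maps the span of the first two unit vectors to itself, which
  puts \<open>k\<close> into \<open>H\<close>, and \<open>g = l^* M k^*\<close>.\<close>

lemma unitary_LBH_decomposition:
  fixes n1 n2 n3 n :: nat
  assumes ge: "2 \<le> n1" "2 \<le> n2" "2 \<le> n3" and sum: "n = n1 + n2 + n3" and g: "g \<in> unitary_group n"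
  obtains l s t a b \<theta> h where
    "l \<in> block_subgroup n (blk3 n1 n2)" "h \<in> block_subgroup n (blk2 2)"
    "g = l * (mat_exp (of_real a \<cdot>\<^sub>m skew n (n1 + 1) n + of_real b \<cdot>\<^sub>m skew n (n1 + 2) (n - 1)) *
      mat_exp (of_real \<theta> \<cdot>\<^sub>m skew n (n1 + 1) (n - 1)) *
      mat_exp (of_real s \<cdot>\<^sub>m skew n 1 n + of_real t \<cdot>\<^sub>m skew n 2 (n - 1))) * h"
proof -
  define m where "m = n - 2"
  have m: "n1 + 2 \<le> m" "n1 + n2 \<le> m" and n: "n = m + 2" using ge sum by (auto simp: m_def)
  let ?bi = "block_inner n (blk3 n1 n2)"
  have gc: "g \<in> carrier_mat n n" using g by (rule unitary_group_carrier)
  define g1 where "g1 = col g 0"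
  define g2 where "g2 = col g 1"
  have gv: "g1 \<in> carrier_vec n" "g2 \<in> carrier_vec n" using gc by (auto simp: g1_def g2_def)
  obtain \<alpha> \<beta> \<gamma> \<delta> where
    ab: "cnj \<alpha> * \<alpha> + cnj \<beta> * \<beta> = 1" and cd: "cnj \<gamma> * \<gamma> + cnj \<delta> * \<delta> = 1"
    and abcd: "cnj \<alpha> * \<gamma> + cnj \<beta> * \<delta> = 0"
    and red0: "cnj \<alpha> * \<gamma> * ?bi 0 g1 g1 + cnj \<alpha> * \<delta> * ?bi 0 g1 g2
      + cnj \<beta> * \<gamma> * ?bi 0 g2 g1 + cnj \<beta> * \<delta> * ?bi 0 g2 g2 = 0"
    and red1: "cnj \<alpha> * \<gamma> * ?bi 1 g1 g1 + cnj \<alpha> * \<delta> * ?bi 1 g1 g2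
      + cnj \<beta> * \<gamma> * ?bi 1 g2 g1 + cnj \<beta> * \<delta> * ?bi 1 g2 g2 \<in> \<real>"
    by (rule simultaneous_unitary_reduction)
  define f1 where "f1 = \<alpha> \<cdot>\<^sub>v g1 + \<beta> \<cdot>\<^sub>v g2"
  define f2 where "f2 = \<gamma> \<cdot>\<^sub>v g1 + \<delta> \<cdot>\<^sub>v g2"
  have fv: "f1 \<in> carrier_vec n" "f2 \<in> carrier_vec n" using gv by (auto simp: f1_def f2_def)
  \<comment> \<open>With the constant labelling there is a single block, so the right-hand side is
    the ordinary inner product, in which the columns of \<open>g\<close> are orthonormal.\<close>
  have total: "?bi 0 v w + ?bi 1 v w + ?bi 2 v w = block_inner n (\<lambda>_. 0) 0 v w" for v w
    using sum_block_inner[of "{0, 1, 2}" n "blk3 n1 n2" v w] sum_block_inner[of "{0}" n "\<lambda>_. 0" v w]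
      blk3_cases by (simp add: add.assoc)
  have orth: "block_inner n (\<lambda>_. 0) 0 (col g i) (col g j) = of_bool (i = j)" if "i < n" "j < n" for i j
    using g that gc sum_block_inner[of "{0}" n "\<lambda>_. 0" "col g i" "col g j"]
    unfolding unitary_group_iff by simp
  have gram: "block_inner n (\<lambda>_. 0) 0 g1 g1 = 1" "block_inner n (\<lambda>_. 0) 0 g2 g2 = 1"
    "block_inner n (\<lambda>_. 0) 0 g1 g2 = 0" "block_inner n (\<lambda>_. 0) 0 g2 g1 = 0"
    using orth[of 0 0] orth[of 0 1] orth[of 1 0] orth[of 1 1] n by (simp_all add: g1_def g2_def)
  have tot: "?bi 0 f1 f1 + ?bi 1 f1 f1 + ?bi 2 f1 f1 = 1" "?bi 0 f2 f2 + ?bi 1 f2 f2 + ?bi 2 f2 f2 = 1"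
    "?bi 0 f1 f2 + ?bi 1 f1 f2 + ?bi 2 f1 f2 = 0"
    unfolding total unfolding f1_def f2_def block_inner_combination[OF gv] gram
    using ab cd abcd by simp_all
  have v0: "?bi 0 f1 f2 = 0" and "?bi 1 f1 f2 \<in> \<real>"
    unfolding f1_def f2_def block_inner_combination[OF gv] by (fact red0 red1)+
  then obtain v where v1: "?bi 1 f1 f2 = of_real v" by (elim Reals_cases)
  have v2: "?bi 2 f1 f2 = of_real (- v)" using tot(3) v0 v1 by (simp add: add_eq_0_iff)
  define u where "u k = Re (?bi k f1 f1)" for k
  define w where "w k = Re (?bi k f2 f2)" for k
  have uw: "?bi k f1 f1 = of_real (u k)" "?bi k f2 f2 = of_real (w k)" "u k \<ge> 0" "w k \<ge> 0" for k
    unfolding u_def w_def block_inner_self by (simp_all add: sum_nonneg)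
  have "complex_of_real (u 0 + u 1 + u 2) = 1" "complex_of_real (w 0 + w 1 + w 2) = 1"
    using tot(1,2) unfolding uw by simp_all
  then have sums: "u 0 + u 1 + u 2 = 1" "w 0 + w 1 + w 2 = 1" unfolding of_real_eq_1_iff by auto
  have CS: "v\<^sup>2 \<le> u 1 * w 1" "v\<^sup>2 \<le> u 2 * w 2"
    using block_inner_Cauchy_Schwarz[of n "blk3 n1 n2" 1 f1 f2]
      block_inner_Cauchy_Schwarz[of n "blk3 n1 n2" 2 f1 f2]
    unfolding v1 v2 uw by simp_all
  obtain s t a b \<theta> where ang:
    "(cos s)\<^sup>2 = u 0" "(sin s * sin a)\<^sup>2 = u 1" "(sin s * cos a)\<^sup>2 = u 2"
    "(cos t)\<^sup>2 = w 0" "(sin t * sin \<theta> * cos a)\<^sup>2 + (sin t * cos \<theta> * sin b)\<^sup>2 = w 1"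
    "(sin t * sin \<theta> * sin a)\<^sup>2 + (sin t * cos \<theta> * cos b)\<^sup>2 = w 2"
    "sin s * sin a * (sin t * sin \<theta> * cos a) = v"
    by (rule gram_angles[OF uw(3) uw(3) uw(3) uw(4) uw(4) uw(4) sums CS])
  define M where "M = mat_exp (of_real a \<cdot>\<^sub>m skew n (n1 + 1) n + of_real b \<cdot>\<^sub>m skew n (n1 + 2) (n - 1)) *
      mat_exp (of_real \<theta> \<cdot>\<^sub>m skew n (n1 + 1) (n - 1)) *
      mat_exp (of_real s \<cdot>\<^sub>m skew n 1 n + of_real t \<cdot>\<^sub>m skew n 2 (n - 1))"
  note rot = rotation_product_columns[OF ge(1) m(1) n]
  have uM: "M \<in> unitary_group n" unfolding M_def by (intro unitary_group_mult rot)
  note Mc = unitary_group_carrier[OF uM]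
  define F1 where "F1 = M *\<^sub>v unit_vec n 0"
  define F2 where "F2 = M *\<^sub>v unit_vec n 1"
  note F = F1_def[unfolded M_def rot(4)] F2_def[unfolded M_def rot(5)]
  have Fv: "F1 \<in> carrier_vec n" "F2 \<in> carrier_vec n" by (simp_all add: F)
  have Fsupp: "i \<in> {0, 1, n1, Suc n1, m, Suc m}" if "i < n" "F1 $ i \<noteq> 0 \<or> F2 $ i \<noteq> 0" for i
    using that by (auto simp: F split: if_splits)
  have Fval: "F1 $ 0 = of_real (cos s)" "F1 $ 1 = 0" "F1 $ n1 = of_real (- (sin s * sin a))"
    "F1 $ Suc n1 = 0" "F1 $ m = 0" "F1 $ Suc m = of_real (- (sin s * cos a))"
    "F2 $ 0 = 0" "F2 $ 1 = of_real (cos t)" "F2 $ n1 = of_real (- (sin t * sin \<theta> * cos a))"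
    "F2 $ Suc n1 = of_real (- (sin t * cos \<theta> * sin b))"
    "F2 $ m = of_real (- (sin t * cos \<theta> * cos b))" "F2 $ Suc m = of_real (sin t * sin \<theta> * sin a)"
    using ge m n by (simp_all add: F)
  \<comment> \<open>Each block contains exactly one of the pairs of coordinates on which
    \<open>F1\<close> and \<open>F2\<close> can be nonzero, so it is enough that one argument is
    such a vector.\<close>
  have bi: "?bi 0 x y = cnj (x $ 0) * y $ 0 + cnj (x $ 1) * y $ 1"
    "?bi 1 x y = cnj (x $ n1) * y $ n1 + cnj (x $ Suc n1) * y $ Suc n1"
    "?bi 2 x y = cnj (x $ m) * y $ m + cnj (x $ Suc m) * y $ Suc m"
    if y: "y \<in> {F1, F2}" for x y
  proof -
    have "?bi 0 x y = (\<Sum>i\<in>{0, 1}. cnj (x $ i) * y $ i)"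
      "?bi 1 x y = (\<Sum>i\<in>{n1, Suc n1}. cnj (x $ i) * y $ i)"
      "?bi 2 x y = (\<Sum>i\<in>{m, Suc m}. cnj (x $ i) * y $ i)"
      by (rule block_inner_support; use ge m n y Fsupp in \<open>force simp: blk3_def\<close>)+
    then show "?bi 0 x y = cnj (x $ 0) * y $ 0 + cnj (x $ 1) * y $ 1"
      "?bi 1 x y = cnj (x $ n1) * y $ n1 + cnj (x $ Suc n1) * y $ Suc n1"
      "?bi 2 x y = cnj (x $ m) * y $ m + cnj (x $ Suc m) * y $ Suc m"
      by simp_all
  qed
  have F1: "F1 \<in> {F1, F2}" and F2: "F2 \<in> {F1, F2}" by auto
  have gramF: "?bi 0 F1 F1 = of_real (u 0)" "?bi 1 F1 F1 = of_real (u 1)" "?bi 2 F1 F1 = of_real (u 2)"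
    "?bi 0 F1 F2 = 0" "?bi 1 F1 F2 = of_real v" "?bi 2 F1 F2 = of_real (- v)"
    "?bi 0 F2 F2 = of_real (w 0)" "?bi 1 F2 F2 = of_real (w 1)" "?bi 2 F2 F2 = of_real (w 2)"
    unfolding bi[OF F1] bi[OF F2] Fval ang[symmetric] by (simp_all add: power2_eq_square)
  \<comment> \<open>\<open>block_subgroup_transitive\<close> compares Gram data for every natural
    number as label; beyond 2 the sums are empty.\<close>
  have bi3: "?bi k x y = 0" if "k \<notin> {0, 1, 2}" for k x y
    using that by (auto simp: block_inner_def blk3_def intro!: sum.neutral split: if_splits)
  have eq: "?bi k f1 f1 = ?bi k F1 F1" "?bi k f1 f2 = ?bi k F1 F2" "?bi k f2 f2 = ?bi k F2 F2" for k
  proof -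
    consider "k = 0" | "k = 1" | "k = 2" | "k \<notin> {0, 1, 2}" by blast
    then have "?bi k f1 f1 = ?bi k F1 F1 \<and> ?bi k f1 f2 = ?bi k F1 F2 \<and> ?bi k f2 f2 = ?bi k F2 F2"
      by cases (simp_all only: uw(1,2)[of 0] uw(1,2)[of 1] uw(1,2)[of 2] v0 v1 v2 gramF bi3 simp_thms)
    then show "?bi k f1 f1 = ?bi k F1 F1" "?bi k f1 f2 = ?bi k F1 F2" "?bi k f2 f2 = ?bi k F2 F2"
      by blast+
  qed
  obtain l where l: "l \<in> block_subgroup n (blk3 n1 n2)" "l *\<^sub>v f1 = F1" "l *\<^sub>v f2 = F2"
    by (rule block_subgroup_transitive[OF fv Fv eq])
  have ul: "l \<in> unitary_group n" using l by (simp add: block_subgroup_def)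
  note lc = unitary_group_carrier[OF ul]
  have lM: "mat_adjoint l * M \<in> carrier_mat n n" using lc Mc by (metis mat_adjoint_carrier mult_carrier_mat)
  define k where "k = mat_adjoint g * (mat_adjoint l * M)"
  have uk: "k \<in> unitary_group n"
    unfolding k_def by (intro unitary_group_mult unitary_group_adjoint g ul uM)
  note kc = unitary_group_carrier[OF uk]
  have kcol: "k $$ (i, j) = 0" if i: "2 \<le> i" "i < n" and j: "j < 2" for i j
  proof -
    \<comment> \<open>The adjoint of \<open>l\<close> undoes \<open>l\<close>, and the adjoint of
      \<open>g\<close> turns coordinates with respect to \<open>g1\<close>, \<open>g2\<close> into
      coordinates with respect to the first two unit vectors.\<close>
    have kvec: "k *\<^sub>v e = \<eta> \<cdot>\<^sub>v unit_vec n 0 + \<zeta> \<cdot>\<^sub>v unit_vec n 1"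
      if "e \<in> carrier_vec n" "M *\<^sub>v e = l *\<^sub>v (\<eta> \<cdot>\<^sub>v g1 + \<zeta> \<cdot>\<^sub>v g2)" for e \<eta> \<zeta>
    proof -
      let ?f = "\<eta> \<cdot>\<^sub>v g1 + \<zeta> \<cdot>\<^sub>v g2"
      have f: "?f \<in> carrier_vec n" using gv by simp
      have "k *\<^sub>v e = mat_adjoint g *\<^sub>v (mat_adjoint l *\<^sub>v (l *\<^sub>v ?f))"
        unfolding k_def assoc_mult_mat_vec[OF mat_adjoint_carrier[OF gc] lM that(1)]
          assoc_mult_mat_vec[OF mat_adjoint_carrier[OF lc] Mc that(1)] that(2) ..
      also have "mat_adjoint l *\<^sub>v (l *\<^sub>v ?f) = ?f"
        using f lc unitary_group_left_inv[OF ul]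
        by (simp flip: assoc_mult_mat_vec[OF mat_adjoint_carrier[OF lc] lc f])
      also have "mat_adjoint g *\<^sub>v ?f = \<eta> \<cdot>\<^sub>v (mat_adjoint g *\<^sub>v g1) + \<zeta> \<cdot>\<^sub>v (mat_adjoint g *\<^sub>v g2)"
        using gv mat_adjoint_carrier[OF gc]
        by (simp add: mult_add_distrib_mat_vec[of _ n n] mult_mat_vec[of _ n n])
      also have "mat_adjoint g *\<^sub>v g1 = unit_vec n 0"
        using n col_mult2[OF mat_adjoint_carrier[OF gc] gc, of 0] unitary_group_left_inv[OF g]
        by (simp add: g1_def)
      also have "mat_adjoint g *\<^sub>v g2 = unit_vec n 1"
        using n col_mult2[OF mat_adjoint_carrier[OF gc] gc, of 1] unitary_group_left_inv[OF g]
        by (simp add: g2_def)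
      finally show ?thesis .
    qed
    have kij: "k $$ (i, j) = (k *\<^sub>v unit_vec n j) $ i"
      using i j kc by simp
    consider "j = 0" | "j = 1" using j by linarith
    then have "(k *\<^sub>v unit_vec n j) $ i = 0"
    proof cases
      case 1
      then show ?thesis
        using kvec[of "unit_vec n 0" \<alpha> \<beta>] l(2) i by (simp add: F1_def f1_def del: index_mult_mat_vec)
    next
      case 2
      then show ?thesis
        using kvec[of "unit_vec n 1" \<gamma> \<delta>] l(3) i by (simp add: F2_def f2_def del: index_mult_mat_vec)
    qed
    then show ?thesis by (simp only: kij)
  qed
  have "k \<in> block_subgroup n (blk2 2)"
    using unitary_block_triangular_imp_block_diagonal[OF uk] n kcol by simp
  then have "mat_adjoint k \<in> block_subgroup n (blk2 2)" by (rule block_subgroup_adjoint)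
  moreover have "mat_adjoint l \<in> block_subgroup n (blk3 n1 n2)" using l(1) by (rule block_subgroup_adjoint)
  moreover have "g = mat_adjoint l * M * mat_adjoint k"
  proof -
    have "g * k = mat_adjoint l * M"
      using assoc_mult_mat[OF gc mat_adjoint_carrier[OF gc] lM] lM
      unfolding k_def unitary_group_right_inv[OF g] by (metis left_mult_one_mat)
    then have "mat_adjoint l * M * mat_adjoint k = g * (k * mat_adjoint k)"
      using assoc_mult_mat[OF gc kc mat_adjoint_carrier[OF kc]] by simp
    then show ?thesis using unitary_group_right_inv[OF uk] gc by simp
  qed
  ultimately show ?thesis unfolding M_def by (intro that)
qed

theorem theorem4p1:
  fixes n n1 n2 n3 p q :: nat
  assumes "n = n1 + n2 + n3" and "n = p + q"
    and "min n1 (min n2 n3) \<ge> 2"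
    and "p = 2" and "q = n - 2"
  defines "G \<equiv> unitary_group n"
    and "L \<equiv> block_subgroup n (blk3 n1 n2)"
    and "H \<equiv> block_subgroup n (blk2 p)"
    and "A1 \<equiv> mat_exp ` rspan2 (skew n 1 n) (skew n 2 (n - 1))"
    and "A' \<equiv> mat_exp ` rspan1 (skew n (n1 + 1) (n - 1))"
    and "A2 \<equiv> mat_exp ` rspan2 (skew n (n1 + 1) n) (skew n (n1 + 2) (n - 1))"
  shows "G = {l * (x * y * z) * h | l x y z h.
              l \<in> L \<and> x \<in> A2 \<and> y \<in> A' \<and> z \<in> A1 \<and> h \<in> H}"
proof (intro equalityI subsetI)
  have ge: "2 \<le> n1" "2 \<le> n2" "2 \<le> n3" using assms(3) by auto
  fix g assume "g \<in> G"
  then obtain l s t a b \<theta> h where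
    "l \<in> L" "h \<in> H"
    "g = l * (mat_exp (of_real a \<cdot>\<^sub>m skew n (n1 + 1) n + of_real b \<cdot>\<^sub>m skew n (n1 + 2) (n - 1)) *
      mat_exp (of_real \<theta> \<cdot>\<^sub>m skew n (n1 + 1) (n - 1)) *
      mat_exp (of_real s \<cdot>\<^sub>m skew n 1 n + of_real t \<cdot>\<^sub>m skew n 2 (n - 1))) * h"
    unfolding G_def L_def H_def \<open>p = 2\<close> by (rule unitary_LBH_decomposition[OF ge assms(1)])
  then show "g \<in> {l * (x * y * z) * h | l x y z h. l \<in> L \<and> x \<in> A2 \<and> y \<in> A' \<and> z \<in> A1 \<and> h \<in> H}"
    unfolding A1_def A2_def A'_def rspan1_def rspan2_def by blast
next
  fix g assume "g \<in> {l * (x * y * z) * h | l x y z h. l \<in> L \<and> x \<in> A2 \<and> y \<in> A' \<and> z \<in> A1 \<and> h \<in> H}"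
  then obtain l x y z h where g: "g = l * (x * y * z) * h" and lh: "l \<in> L" "h \<in> H"
    and xyz: "x \<in> A2" "y \<in> A'" "z \<in> A1"
    by blast
  \<comment> \<open>The role of \<open>m\<close> is played by \<open>n - 2\<close>; the last two
    blocks together have size at least 4, which gives the middle inequality.\<close>
  have n: "2 \<le> n1" "n1 + 2 \<le> n - 2" "n = (n - 2) + 2" using assms(1,3) by auto
  from lh have "l \<in> unitary_group n" "h \<in> unitary_group n"
    by (simp_all add: L_def H_def block_subgroup_def)
  moreover from xyz have "x \<in> unitary_group n" "y \<in> unitary_group n" "z \<in> unitary_group n"
    unfolding A1_def A2_def A'_def rspan1_def rspan2_def
    using rotation_product_columns(1-3)[OF n] by blast+
  ultimately show "g \<in> G" unfolding g G_def by (intro unitary_group_mult)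
qed

end
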